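(* Let $u\in C_{c,+}(\mathbb R^3;\mathbb R)$ be an admissible attenuation coefficient with center $\mathcal C_3\in\mathbb R^3$. Then for every $T\in C(\mathbb R;\mathbb R^3)$, every $R\in C(\mathbb R;SO(3))$ and every $t\in\mathbb R$, $$P(\mathcal C_3-T(t))=\mathcal C_2(t),\qquad\text{where}\quad \mathcal C_2(t):=\frac{1}{\int_{\mathbb R^2}\mathcal J[T,R](t,x)\,dx}\int_{\mathbb R^2}\begin{pmatrix}x_1\\ x_2\end{pmatrix}\mathcal J[T,R](t,x)\,dx$$ is the two-dimensional center of the attenuation mapping $\mathcal J[T,R](t,\cdot)$ of $u$.
   Context: $C_{c,+}(\mathbb R^3;\mathbb R)=\{u\in C(\mathbb R^3;\mathbb R)\mid \operatorname{supp}(u)\neq\emptyset\text{ is compact},\ u\ge 0\}$ is the space of admissible attenuation coefficients. The center of $u$ is $\mathcal C_3:=\frac{1}{\int_{\mathbb R^3}u(x)\,dx}\int_{\mathbb R^3}x\,u(x)\,dx\in\mathbb R^3$. For $T\in C(\mathbb R;\mathbb R^3)$ (translation) and $R\in C(\mathbb R;SO(3))$ (rotation), the attenuation mapping of $u$ is $$\mathcal J[T,R](t,x_1,x_2)=\int_{-\infty}^{\infty}u\big(\mathcal C_3+R(t)(x-\mathcal C_3+T(t))\big)\,dx_3,\qquad x=(x_1,x_2,x_3)^T.$$ $P:\mathbb R^3\to\mathbb R^2$, $P(x)=(x_1,x_2)^T$, is the orthogonal projection onto the $x_1x_2$-plane. *)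

theory Defs
  imports "HOL-Analysis.Analysis"
begin

definition admissible :: "(real^3 \<Rightarrow> real) set" where
  "admissible = {u. continuous_on UNIV u \<and>
     closure (support_on UNIV u) \<noteq> {} \<and> compact (closure (support_on UNIV u)) \<and>
     (\<forall>x. u x \<ge> 0)}"

definition SO3 :: "(real^3^3) set" where
  "SO3 = {A. rotation_matrix A}"

(* Used both for the coefficient u on R^3 and for its attenuation mapping on R^2. *)
definition center :: "('a::euclidean_space \<Rightarrow> real) \<Rightarrow> 'a" where
  "center f = (1 / (LINT x|lborel. f x)) *\<^sub>R (LINT x|lborel. f x *\<^sub>R x)"

definition attenuation ::
    "(real^3 \<Rightarrow> real) \<Rightarrow> (real \<Rightarrow> real^3) \<Rightarrow> (real \<Rightarrow> real^3^3) \<Rightarrow> real \<Rightarrow> real^2 \<Rightarrow> real" where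
  "attenuation u T R t x =
     (LINT s|lborel. u (center u + R t *v (vector [x$1, x$2, s] - center u + T t)))"

definition proj12 :: "real^3 \<Rightarrow> real^2" where
  "proj12 x = vector [x$1, x$2]"

end

theory Submission
  imports Defs
begin

text \<open>Substituting the rigid motion \<open>y = \<C>\<^sub>3 + R(t) (x - \<C>\<^sub>3 + T(t))\<close>, which preserves Lebesgue measure
  and carries \<open>\<C>\<^sub>3 - T(t)\<close> to \<open>\<C>\<^sub>3\<close>, shows that the moved coefficient has the same mass as
  \<open>u\<close> and center \<open>\<C>\<^sub>3 - T(t)\<close>. By Fubini, integrating out \<open>x\<^sub>3\<close> keeps the mass and projects
  the first moment.\<close>

lemma borel_measurable_orthogonal_transformation:
  fixes h :: "'a::euclidean_space \<Rightarrow> 'a"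
  assumes "orthogonal_transformation h"
  shows "h \<in> borel_measurable borel"
  using assms by (intro borel_measurable_continuous_onI linear_continuous_on)
    (simp add: orthogonal_transformation_linear linear_conv_bounded_linear[symmetric])

text \<open>Lebesgue measure is determined by its values on boxes. The preimage of a box under
  \<open>h\<close> is its image under the inverse \<open>g\<close>, which is again orthogonal and so
  preserves volume.\<close>

lemma lborel_distr_orthogonal_transformation:
  fixes h :: "real^'n::{finite,wellorder} \<Rightarrow> real^'n::_"
  assumes h: "orthogonal_transformation h"
  shows "distr lborel borel h = lborel"
proof (rule lborel_eqI[symmetric])
  fix l u :: "real^'n::_"
  assume lu: "\<And>b. b \<in> Basis \<Longrightarrow> l \<bullet> b \<le> u \<bullet> b"
  obtain g where g: "orthogonal_transformation g" and gh: "\<And>x. g (h x) = x" and hg: "\<And>x. h (g x) = x"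
    using h orthogonal_transformation_inv[OF h] orthogonal_transformation_bij[OF h]
    by (metis bij_inv_eq_iff)
  note meas = borel_measurable_orthogonal_transformation[OF h]
  have vim: "h -` box l u = g ` box l u"
    using gh hg by (auto simp: image_iff) metis
  have sets: "h -` box l u \<in> sets borel"
    using measurable_sets[OF meas, of "box l u"] by simp
  have box: "box l u \<in> lmeasurable" by simp
  have "emeasure (distr lborel borel h) (box l u) = emeasure lborel (h -` box l u)"
    using meas by (simp add: emeasure_distr)
  also have "\<dots> = emeasure lebesgue (g ` box l u)"
    using sets by (simp add: vim[symmetric])
  also have "\<dots> = ennreal (measure lebesgue (g ` box l u))"
    using measurable_orthogonal_image[OF g box] by (simp add: emeasure_eq_measure2)
  also have "\<dots> = ennreal (measure lebesgue (box l u))"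
    using measure_orthogonal_image[OF g box] by simp
  also have "\<dots> = (\<Prod>b\<in>Basis. (u - l) \<bullet> b)"
    using lu by (simp add: measure_lborel_box_eq)
  finally show "emeasure (distr lborel borel h) (box l u) = (\<Prod>b\<in>Basis. (u - l) \<bullet> b)" .
qed simp

lemma lborel_distr_rigid_motion:
  fixes h :: "real^'n::{finite,wellorder} \<Rightarrow> real^'n::_"
  assumes h: "orthogonal_transformation h"
  shows "distr lborel borel (\<lambda>x. a + h (x + b)) = lborel"
proof -
  note meas = borel_measurable_orthogonal_transformation[OF h]
  have "distr lborel borel (\<lambda>x. a + h (x + b)) =
      distr (distr (distr lborel borel ((+) b)) borel h) borel ((+) a)"
    using meas by (simp add: distr_distr o_def add.commute)
  then show ?thesis
    by (simp add: lborel_distr_plus lborel_distr_orthogonal_transformation[OF h])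
qed

text \<open>The types \<open>(real^2) \<times> real\<close> and \<open>real^3\<close> are distinct,
  so Fubini on the product has to be transported along this explicit isomorphism.\<close>

definition cart3 :: "(real^2) \<times> real \<Rightarrow> real^3" where
  "cart3 = (\<lambda>(p, s). vector [p$1, p$2, s])"

lemma measurable_cart3: "cart3 \<in> borel_measurable borel"
proof -
  have "continuous_on UNIV (\<lambda>q. cart3 q $ i)" for i
    using exhaust_3[of i]
    by (elim disjE) (simp_all add: cart3_def case_prod_beta continuous_intros)
  then have "continuous_on UNIV (\<lambda>q. \<chi> i. cart3 q $ i)"
    by (rule continuous_on_vec_lambda)
  then show ?thesis
    by (intro borel_measurable_continuous_onI) simp
qed

text \<open>Turns the volume of a box, a product over \<open>Basis\<close>, into a product over
  coordinates; distinct indices give distinct axis vectors.\<close>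

lemma prod_Basis_cart:
  fixes f :: "real^'n \<Rightarrow> 'a::comm_monoid_mult"
  shows "(\<Prod>b\<in>Basis. f b) = (\<Prod>i\<in>UNIV. f (axis i 1))"
  by (simp add: Basis_vec_def UNION_singleton_eq_range prod.reindex inj_on_def axis_eq_axis)

text \<open>The preimage of a box is a planar box times an interval, so its product measure is the
  product of the three side lengths. Agreement on boxes suffices.\<close>

lemma lborel_distr_cart3: "distr (lborel \<Otimes>\<^sub>M lborel) borel cart3 = lborel"
proof (rule lborel_eqI[symmetric])
  fix l u :: "real^3"
  assume "\<And>b. b \<in> Basis \<Longrightarrow> l \<bullet> b \<le> u \<bullet> b"
  then have lu: "l $ i \<le> u $ i" for i
    by (metis axis_in_Basis_iff cart_eq_inner_axis Basis_real_def insertI1)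
  have vim: "cart3 -` box l u = box (proj12 l) (proj12 u) \<times> box (l$3) (u$3)"
    by (auto simp: mem_box_cart cart3_def proj12_def forall_2 forall_3)
  have "emeasure (distr (lborel \<Otimes>\<^sub>M lborel) borel cart3) (box l u)
      = emeasure (lborel \<Otimes>\<^sub>M lborel) (cart3 -` box l u)"
    using measurable_cart3 by (simp add: emeasure_distr lborel_prod)
  also have "\<dots> = emeasure lborel (box (proj12 l) (proj12 u)) * emeasure lborel (box (l$3) (u$3))"
    unfolding vim by (rule lborel.emeasure_pair_measure_Times) auto
  also have "emeasure lborel (box (l$3) (u$3)) = ennreal (u$3 - l$3)"
    using lu by (simp add: box_real)
  also have "emeasure lborel (box (proj12 l) (proj12 u)) = ennreal ((u$1 - l$1) * (u$2 - l$2))"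
  proof -
    have "\<forall>b\<in>Basis. proj12 l \<bullet> b \<le> proj12 u \<bullet> b"
      using lu by (auto simp: Basis_vec_def inner_axis proj12_def vector_def)
    then show ?thesis
      by (simp add: emeasure_lborel_box_eq prod_Basis_cart inner_axis) (simp add: UNIV_2 proj12_def)
  qed
  also have "ennreal ((u$1 - l$1) * (u$2 - l$2)) * ennreal (u$3 - l$3)
      = ennreal ((u$1 - l$1) * (u$2 - l$2) * (u$3 - l$3))"
    using lu by (intro ennreal_mult[symmetric]) auto
  also have "(u$1 - l$1) * (u$2 - l$2) * (u$3 - l$3) = (\<Prod>i\<in>UNIV. u$i - l$i)"
    unfolding UNIV_3 by (simp add: mult.assoc)
  also have "\<dots> = (\<Prod>b\<in>Basis. (u - l) \<bullet> b)"
    by (simp add: prod_Basis_cart inner_axis)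
  finally show "emeasure (distr (lborel \<Otimes>\<^sub>M lborel) borel cart3) (box l u)
      = (\<Prod>b\<in>Basis. (u - l) \<bullet> b)" .
qed simp

text \<open>Fubini transported along \<open>cart3\<close>. The values lie in a Banach space because
  both the real mass and the planar first moment are integrated this way.\<close>

lemma integral_lborel_cart3:
  fixes f :: "real^3 \<Rightarrow> 'b::{banach,second_countable_topology}"
  assumes f: "integrable lborel f"
  shows "(LINT p|lborel. LINT s|lborel. f (vector [p$1, (p::real^2)$2, s])) = (LINT x|lborel. f x)"
proof -
  have m: "cart3 \<in> (lborel \<Otimes>\<^sub>M lborel) \<rightarrow>\<^sub>M borel"
    using measurable_cart3 by (simp add: lborel_prod)
  have "integrable (distr (lborel \<Otimes>\<^sub>M lborel) borel cart3) f"
    using f by (simp add: lborel_distr_cart3)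
  then have "integrable (lborel \<Otimes>\<^sub>M lborel) (\<lambda>q. f (cart3 q))"
    by (rule integrable_distr[OF m])
  then have "(LINT p|lborel. LINT s|lborel. f (cart3 (p, s))) =
      (LINT q|(lborel \<Otimes>\<^sub>M lborel). f (cart3 q))"
    by (rule lborel_pair.integral_fst')
  also have "\<dots> = integral\<^sup>L (distr (lborel \<Otimes>\<^sub>M lborel) borel cart3) f"
    using m f by (intro integral_distr[symmetric]) auto
  finally show ?thesis
    by (simp add: lborel_distr_cart3) (simp add: cart3_def)
qed

lemma bounded_linear_proj12: "bounded_linear proj12"
  by (simp add: linear_conv_bounded_linear[symmetric] linear_iff proj12_def vec_eq_iff forall_2)

text \<open>Multiplying by the indicator of the compact set \<open>closure S\<close> does not change
  \<open>f\<close>. Keeping \<open>S\<close> separate from \<open>f\<close> lets the support of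
  \<open>u\<close> serve for both \<open>u\<close> and its first moment.\<close>

lemma integrable_continuous_compact_support:
  fixes f :: "'a::euclidean_space \<Rightarrow> 'b::{banach,second_countable_topology}"
  assumes "continuous_on UNIV f" "compact (closure S)" "\<And>x. x \<notin> S \<Longrightarrow> f x = 0"
  shows "integrable lborel f"
proof -
  have "integrable lborel (\<lambda>x. indicator (closure S) x *\<^sub>R f x)"
    using assms by (intro borel_integrable_compact) (auto intro: continuous_on_subset)
  moreover have "indicator (closure S) x *\<^sub>R f x = f x" for x
    using assms(3)[of x] closure_subset[of S] by (auto simp: indicator_def)
  ultimately show ?thesis by simp
qed

lemma admissible_integrable:
  assumes "u \<in> admissible"
  shows "integrable lborel u" "integrable lborel (\<lambda>x. u x *\<^sub>R x)"
  using assms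
  by (auto simp: admissible_def support_on_def intro!: continuous_intros
      integrable_continuous_compact_support[of _ "support_on UNIV u"])

text \<open>A nonnegative function with zero integral vanishes almost everywhere. By continuity its
  zero set is closed, and a closed set of full measure is the whole space, contradicting the
  nonempty support.\<close>

lemma admissible_integral_nonzero:
  assumes u: "u \<in> admissible"
  shows "(LINT x|lborel. u x) \<noteq> 0"
proof
  assume "(LINT x|lborel. u x) = 0"
  then have "AE x in lborel. u x = 0"
    using u admissible_integrable(1)[OF u]
    by (subst integral_nonneg_eq_0_iff_AE[symmetric]) (auto simp: admissible_def)
  then have "AE x in lebesgue. x \<in> {x. u x = 0}"
    by (simp add: AE_completion)
  moreover have "closed {x. u x = 0}"
    using u by (intro closed_Collect_eq) (auto simp: admissible_def)
  ultimately have "u x = 0" for x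
    using mem_closed_if_AE_lebesgue by blast
  then show False
    using u by (auto simp: admissible_def support_on_def)
qed

text \<open>If \<open>f\<close> is not integrable, both sides are 0, the junk value of the integral.\<close>

lemma integral_scaleR_left_unconditional:
  fixes c :: "'a::euclidean_space"
  shows "(LINT x|M. f x *\<^sub>R c) = (LINT x|M. f x) *\<^sub>R c"
proof (rule integral_bounded_linear')
  \<comment> \<open>For \<open>c \<noteq> 0\<close> this is a left inverse of scaling
    \<open>c\<close>, which carries integrability of the scaled function back to \<open>f\<close>.
    For \<open>c = 0\<close> both sides vanish.\<close>
  show "bounded_linear (\<lambda>x. (x \<bullet> c) / (c \<bullet> c))"
    by (intro bounded_linear_divide[THEN bounded_linear_compose] bounded_linear_inner_left)
qed (auto intro: bounded_linear_scaleR_left)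

lemma center_eqI:
  assumes "(LINT x|lborel. f x *\<^sub>R x) = (LINT x|lborel. f x) *\<^sub>R c" "(LINT x|lborel. f x) \<noteq> 0"
  shows "center f = c"
  using assms by (simp add: center_def)

lemma integral_scaleR_center:
  assumes "(LINT x|lborel. f x) \<noteq> 0"
  shows "(LINT x|lborel. f x *\<^sub>R x) = (LINT x|lborel. f x) *\<^sub>R center f"
  using assms by (simp add: center_def)

text \<open>Substituting \<open>y = A x\<close> turns the first moment of \<open>v\<close> into the
  integral of \<open>u y *\<^sub>R B y\<close>, where \<open>B\<close> inverts the motion. This
  \<open>B\<close> is affine and sends the center of \<open>u\<close> to
  \<open>center u - a\<close>.\<close>

lemma rigid_motion_moments:
  fixes u :: "real^'n::{finite,wellorder} \<Rightarrow> real" and Q :: "real^'n::_^'n::_" and a :: "real^'n::_"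
  assumes Q: "orthogonal_matrix Q"
    and u: "integrable lborel u" "integrable lborel (\<lambda>x. u x *\<^sub>R x)" "(LINT x|lborel. u x) \<noteq> 0"
  defines "v \<equiv> \<lambda>x. u (center u + Q *v (x - center u + a))"
  shows "integrable lborel v" "integrable lborel (\<lambda>x. v x *\<^sub>R x)"
    and "(LINT x|lborel. v x) = (LINT x|lborel. u x)"
    and "(LINT x|lborel. v x *\<^sub>R x) = (LINT x|lborel. u x) *\<^sub>R (center u - a)"
proof -
  define c where "c = center u"
  \<comment> \<open>The two translations before the rotation are merged to match the form of
    \<open>lborel_distr_rigid_motion\<close>.\<close>
  define A where "A = (\<lambda>x. c + Q *v (x + (a - c)))"
  have v: "v = (\<lambda>x. u (A x))"
    by (simp add: v_def A_def c_def algebra_simps)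
  have orth: "orthogonal_transformation ((*v) Q)"
    using Q by (simp add: orthogonal_transformation_matrix)
  have mA: "A \<in> borel_measurable borel"
    unfolding A_def by (intro borel_measurable_continuous_onI continuous_intros
        bounded_linear.continuous_on[of "(*v) Q"]) simp
  have dA: "distr lborel borel A = lborel"
    unfolding A_def by (rule lborel_distr_rigid_motion[OF orth])
  have mA': "A \<in> lborel \<rightarrow>\<^sub>M borel" using mA by simp
  \<comment> \<open>Left inverse of \<open>A\<close>, as the transpose of \<open>Q\<close> is its
    inverse. It expresses the weight \<open>x\<close> through \<open>y = A x\<close>.\<close>
  define B where "B = (\<lambda>y. transpose Q *v (y - c) + (c - a))"
  have BA: "B (A x) = x" for x
  proof -
    have "transpose Q *v (Q *v z) = z" for z
      using Q by (metis matrix_vector_mul_assoc matrix_vector_mul_lid orthogonal_matrix_def)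
    then show ?thesis
      unfolding A_def B_def add_diff_cancel_left' by simp
  qed
  have ibc: "integrable lborel (\<lambda>y. u y *\<^sub>R (y - c))"
    using u by (simp add: scaleR_diff_right)
  have bl: "bounded_linear ((*v) (transpose Q))" by simp
  \<comment> \<open>Expanding around \<open>c\<close> isolates a linear term whose integral vanishes
    because \<open>c\<close> is the center.\<close>
  have B: "u y *\<^sub>R B y = transpose Q *v (u y *\<^sub>R (y - c)) + u y *\<^sub>R (c - a)" for y
    by (simp add: B_def scaleR_add_right matrix_vector_mult_scaleR)
  have uB: "integrable lborel (\<lambda>y. u y *\<^sub>R B y)"
    unfolding B using u ibc by (intro Bochner_Integration.integrable_add integrable_bounded_linear[OF bl]) auto
  show "integrable lborel v"
    unfolding v using integrable_distr[OF mA', of u] dA u by simp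
  show "integrable lborel (\<lambda>x. v x *\<^sub>R x)"
    unfolding v using integrable_distr[OF mA', of "\<lambda>y. u y *\<^sub>R B y"] dA uB by (simp add: BA)
  show "(LINT x|lborel. v x) = (LINT x|lborel. u x)"
    unfolding v using integral_distr[OF mA', of u] dA u by simp
  have zero: "(LINT y|lborel. u y *\<^sub>R (y - c)) = 0"
    using u by (simp add: scaleR_diff_right integral_scaleR_center c_def)
  have "(LINT x|lborel. v x *\<^sub>R x) = (LINT y|lborel. u y *\<^sub>R B y)"
    unfolding v using integral_distr[OF mA', of "\<lambda>y. u y *\<^sub>R B y"] dA uB by (simp add: BA)
  also have "\<dots> = (LINT y|lborel. transpose Q *v (u y *\<^sub>R (y - c))) + (LINT y|lborel. u y *\<^sub>R (c - a))"
    unfolding B using u ibc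
    by (intro Bochner_Integration.integral_add integrable_bounded_linear[OF bl]) auto
  also have "\<dots> = (LINT x|lborel. u x) *\<^sub>R (c - a)"
    using integral_bounded_linear[OF bl ibc] zero u by simp
  finally show "(LINT x|lborel. v x *\<^sub>R x) = (LINT x|lborel. u x) *\<^sub>R (center u - a)"
    by (simp add: c_def)
qed

theorem proposition3p3:
  fixes u :: "real^3 \<Rightarrow> real"
    and T :: "real \<Rightarrow> real^3"
    and R :: "real \<Rightarrow> real^3^3"
    and t :: real
  assumes "u \<in> admissible"
    and "continuous_on UNIV T"
    and "continuous_on UNIV R"
    and "\<And>s. R s \<in> SO3"
  shows "proj12 (center u - T t) = center (attenuation u T R t)"
proof -
  define v where "v x = u (center u + R t *v (x - center u + T t))" for x
  let ?M = "LINT x|lborel. u x"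
  have Q: "orthogonal_matrix (R t)"
    using assms(4)[of t] by (simp add: SO3_def rotation_matrix_def)
  note M = admissible_integral_nonzero[OF assms(1)]
  note mom = rigid_motion_moments[OF Q admissible_integrable[OF assms(1)] M, of "T t", folded v_def]
  have att: "attenuation u T R t p = (LINT s|lborel. v (vector [p$1, p$2, s]))" for p
    by (simp add: attenuation_def v_def)
  have mass: "(LINT p|lborel. attenuation u T R t p) = ?M"
    unfolding att using integral_lborel_cart3[OF mom(1)] mom(3) by simp
  \<comment> \<open>Every point on the line over \<open>p\<close> projects to \<open>p\<close>, so
    \<open>p\<close> moves inside the integral. Integrability of \<open>v\<close> on space controls
    only almost every line, hence the scaling rule that holds unconditionally.\<close>
  have slice: "attenuation u T R t p *\<^sub>R p =
      (LINT s|lborel. v (vector [p$1, p$2, s]) *\<^sub>R proj12 (vector [p$1, p$2, s]))" for p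
  proof -
    have "proj12 (vector [p$1, p$2, s]) = p" for s
      by (simp add: proj12_def vec_eq_iff forall_2)
    then show ?thesis by (simp only: att integral_scaleR_left_unconditional)
  qed
  have lin: "v x *\<^sub>R proj12 x = proj12 (v x *\<^sub>R x)" for x
    by (simp add: bounded_linear_proj12 linear_simps)
  \<comment> \<open>The integrand is a bounded linear image of the integrable first moment of
    \<open>v\<close>, so Fubini applies and \<open>proj12\<close> then commutes with the
    integral.\<close>
  have "(LINT p|lborel. attenuation u T R t p *\<^sub>R p) = (LINT x|lborel. proj12 (v x *\<^sub>R x))"
    unfolding slice lin
    by (intro integral_lborel_cart3 integrable_bounded_linear[OF bounded_linear_proj12] mom(2))
  also have "\<dots> = proj12 (?M *\<^sub>R (center u - T t))"
    using integral_bounded_linear[OF bounded_linear_proj12 mom(2)] mom(4) by simp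
  also have "\<dots> = ?M *\<^sub>R proj12 (center u - T t)"
    by (simp add: bounded_linear_proj12 linear_simps)
  finally show ?thesis
    \<comment> \<open>Projected moment and mass share the nonzero factor \<open>?M\<close>, which
      cancels in the quotient.\<close>
    using M mass by (intro center_eqI[symmetric]) auto
qed

end
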